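(* Let $d\ge 2$ be an integer, let $\theta=\theta_d>0$ be any real number such that $(d-1)\theta<2\pi/3$, and let $$\eta_d=\sin\frac{\theta}{2}\cos\frac{(d-1)\theta}{2}.$$ Then $0<\eta_d<1$; moreover, $\theta_d$ can be chosen so that $\eta_2=0.5$, $\eta_3=\sqrt{6}/9\approx 0.272$, $\eta_4\approx 0.184$, and $\eta_d=\Omega(1/d)$ (that is, there is an absolute constant $c>0$ such that for every $d\ge 2$ one can choose $\theta_d$ with $\eta_d\ge c/d$). For every positive integer $n$ and every $d$-dimensional complex $n\times\cdots\times n$ array $Z=(z_{i_1\ldots i_d})$ such that $$\left|1-z_{i_1\ldots i_d}\right|\le\eta_d\quad\text{for all }1\le i_1,\dots,i_d\le n,$$ one has $\operatorname{PER}Z\ne 0$.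
   Context: The permanent of a $d$-dimensional $n\times\cdots\times n$ array (tensor) $A=(a_{i_1\ldots i_d})$ of $n^d$ real or complex numbers is $$\operatorname{PER}A=\sum_{\sigma_2,\dots,\sigma_d\in S_n}\ \prod_{i=1}^n a_{i\,\sigma_2(i)\ldots\sigma_d(i)},$$ where $S_n$ is the symmetric group of permutations of $\{1,\dots,n\}$. *)

theory Defs
  imports Complex_Main "HOL-Combinatorics.Permutations" "HOL-Library.FuncSet"
begin

text \<open>
  A \<open>d\<close>-dimensional \<open>n \<times> \<dots> \<times> n\<close> array over \<open>'a\<close> is a function \<open>A :: nat list \<Rightarrow> 'a\<close>, the entry
  with indices \<open>i\<^sub>1, \<dots>, i\<^sub>d\<close> being \<open>A [i\<^sub>1, \<dots>, i\<^sub>d]\<close>. Only the values on \<open>tensor_indices d n\<close>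
  are meaningful.
\<close>

definition tensor_indices :: "nat \<Rightarrow> nat \<Rightarrow> nat list set" where
  "tensor_indices d n = {js. length js = d \<and> set js \<subseteq> {1..n}}"

text \<open>
  The family \<open>\<sigma>\<^sub>2, \<dots>, \<sigma>\<^sub>d\<close> is an extensional function on \<open>{2..d}\<close>, so that each family is counted
  exactly once; the index list in the product is \<open>[i, \<sigma>\<^sub>2 i, \<dots>, \<sigma>\<^sub>d i]\<close>.
\<close>

definition PER :: "nat \<Rightarrow> nat \<Rightarrow> (nat list \<Rightarrow> 'a::comm_ring_1) \<Rightarrow> 'a" where
  "PER d n A =
     (\<Sum>\<sigma> \<in> {2..d} \<rightarrow>\<^sub>E {p. p permutes {1..n}}.
        \<Prod>i = 1..n. A (i # map (\<lambda>k. \<sigma> k i) [2..<Suc d]))"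

definition eta :: "nat \<Rightarrow> real \<Rightarrow> real" where
  "eta d \<theta> = sin (\<theta> / 2) * cos ((real d - 1) * \<theta> / 2)"

end

theory Submission
  imports Defs
begin

text \<open>
  Write the permanent as a sum over \<open>d\<close>-dimensional matchings: sets of index tuples each of whose
  coordinate projections is a bijection onto \<open>{1..n}\<close>. In this form all coordinates play the same
  role and each coordinate may run over its own index set \<open>S k\<close>, so that the permanents of the
  subarrays are values of the same function \<open>matching_sum\<close> at smaller index sets.

  Two statements are proved together by induction on \<open>n\<close>, for all arrays whose entries lie within
  \<open>\<eta>\<^sub>d\<close> of \<open>1\<close> (\<open>exchange_stable_if_near_one\<close>): the permanent is not zero, and replacing one index
  \<open>a \<in> S k\<close> by a new index \<open>b\<close> turns it by an angle of at most \<open>\<theta>\<close>. Expand along the slice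
  \<open>t k = a\<close>: the permanent is \<open>\<Sum>\<^sub>t f t * p t\<close>, where \<open>p t\<close> is the permanent of the array without
  the tuple \<open>t\<close>. Two such tuples agree in coordinate \<open>k\<close>, so their minors arise from each other by
  at most \<open>d - 1\<close> exchanges, and by induction all \<open>p t\<close> lie pairwise within the angle
  \<open>\<alpha> = (d - 1) * \<theta> < 2 * pi / 3\<close>. Such numbers lie in a common sector of angle \<open>\<alpha>\<close>, hence hardly
  cancel: \<open>cos (\<alpha> / 2) * (\<Sum>\<^sub>t \<bar>p t\<bar>) \<le> \<bar>\<Sum>\<^sub>t p t\<bar>\<close> (\<open>norm_sum_ge_of_within_angle\<close>). Passing from
  the coefficients \<open>1\<close> to the coefficients \<open>f t\<close> therefore moves the sum \<open>q = \<Sum>\<^sub>t p t\<close> by at most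
  \<open>\<eta>\<^sub>d / cos (\<alpha> / 2) * \<bar>q\<bar> = sin (\<theta> / 2) * \<bar>q\<bar>\<close>, and this turns it by at most \<open>\<theta> / 2\<close>
  (\<open>within_angle_weighted_sum\<close>). After the exchange of \<open>a\<close> for \<open>b\<close> the expansion has the very same
  minors \<open>p t\<close> with other coefficients, so both permanents are within \<open>\<theta> / 2\<close> of \<open>q\<close> and within
  \<open>\<theta>\<close> of each other.
\<close>

section \<open>Complex numbers in a sector\<close>

text \<open>
  Angles are measured by a real multiplier \<open>\<phi>\<close> rather than by \<open>Arg\<close>: the bounds then add along a
  chain without any reduction modulo \<open>2 * pi\<close>.
\<close>

definition within_angle :: "real \<Rightarrow> complex \<Rightarrow> complex \<Rightarrow> bool" where
  "within_angle \<alpha> z w \<longleftrightarrow> z \<noteq> 0 \<and> (\<exists>r>0. \<exists>\<phi>. \<bar>\<phi>\<bar> \<le> \<alpha> \<and> w = z * rcis r \<phi>)"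

lemma within_angle_refl: "z \<noteq> 0 \<Longrightarrow> 0 \<le> \<alpha> \<Longrightarrow> within_angle \<alpha> z z"
  unfolding within_angle_def by (intro conjI exI[of _ 1] exI[of _ 0]) auto

lemma within_angle_nonzero: "within_angle \<alpha> z w \<Longrightarrow> w \<noteq> 0"
  unfolding within_angle_def by auto

lemma within_angle_trans:
  assumes "within_angle \<alpha> z w" "within_angle \<beta> w v"
  shows "within_angle (\<alpha> + \<beta>) z v"
proof -
  obtain r \<phi> where 1: "z \<noteq> 0" "r > 0" "\<bar>\<phi>\<bar> \<le> \<alpha>" "w = z * rcis r \<phi>"
    using assms(1) unfolding within_angle_def by auto
  obtain s \<psi> where 2: "s > 0" "\<bar>\<psi>\<bar> \<le> \<beta>" "v = w * rcis s \<psi>"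
    using assms(2) unfolding within_angle_def by auto
  have "v = z * rcis (r * s) (\<phi> + \<psi>)"
    using 1(4) 2(3) rcis_mult[of r \<phi> s \<psi>] by (simp add: mult.assoc)
  moreover have "\<bar>\<phi> + \<psi>\<bar> \<le> \<alpha> + \<beta>" using 1 2 by linarith
  ultimately show ?thesis using 1(1,2) 2(1) unfolding within_angle_def
    by (metis mult_pos_pos)
qed

lemma within_angle_sym:
  assumes "within_angle \<alpha> z w"
  shows "within_angle \<alpha> w z"
proof -
  obtain r \<phi> where 1: "z \<noteq> 0" "r > 0" "\<bar>\<phi>\<bar> \<le> \<alpha>" "w = z * rcis r \<phi>"
    using assms unfolding within_angle_def by auto
  have "z = w * rcis (1 / r) (- \<phi>)"
    using 1 rcis_mult[of r \<phi> "1 / r" "- \<phi>"] by (simp add: mult.assoc)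
  moreover have "1 / r > 0" "\<bar>- \<phi>\<bar> \<le> \<alpha>" using 1 by auto
  ultimately show ?thesis
    using within_angle_nonzero[OF assms] unfolding within_angle_def by blast
qed

text \<open>
  The disc of radius \<open>sin \<beta>\<close> about \<open>1\<close> touches the rays of argument \<open>\<plusminus>\<beta>\<close> and hence lies in the
  sector between them. In formulas, for \<open>\<zeta> = rcis r \<phi>\<close> one has
  \<open>\<bar>\<zeta> - 1\<bar>\<^sup>2 = (r - cos \<phi>)\<^sup>2 + (sin \<phi>)\<^sup>2\<close>.
\<close>

lemma within_angle_perturb:
  assumes "q \<noteq> 0" "cmod (w - q) \<le> sin \<beta> * cmod q" "0 < \<beta>" "\<beta> < pi / 2"
  shows "within_angle \<beta> q w"
proof -
  define \<zeta> where "\<zeta> = w / q"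
  have w: "w = q * \<zeta>" using assms(1) by (simp add: \<zeta>_def)
  have "cmod (w - q) = cmod q * cmod (\<zeta> - 1)"
    unfolding w by (metis mult.right_neutral norm_mult right_diff_distrib)
  with assms(1,2) have d: "cmod (\<zeta> - 1) \<le> sin \<beta>" by (simp add: mult.commute)
  have "sin \<beta> < sin (pi / 2)" using assms(3,4) by (intro sin_monotone_2pi) auto
  hence sb: "sin \<beta> < 1" by simp
  define r \<phi> where "r = cmod \<zeta>" and "\<phi> = Arg \<zeta>"
  have z: "\<zeta> = rcis r \<phi>" unfolding r_def \<phi>_def by (simp add: rcis_cmod_Arg)
  have "\<bar>Re (\<zeta> - 1)\<bar> \<le> cmod (\<zeta> - 1)" by (rule abs_Re_le_cmod)
  hence re: "Re \<zeta> > 0" using d sb by simp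
  hence r0: "r > 0" unfolding r_def by auto
  have cp: "cos \<phi> > 0" using re r0 unfolding z by (simp add: zero_less_mult_iff)
  have phi: "- pi < \<phi>" "\<phi> \<le> pi" unfolding \<phi>_def using Arg_bounded[of \<zeta>] by auto
  have lt: "\<bar>\<phi>\<bar> < pi / 2"
  proof (rule ccontr)
    assume "\<not> ?thesis"
    hence "cos \<bar>\<phi>\<bar> \<le> cos (pi / 2)" using phi by (intro cos_monotone_0_pi_le) auto
    thus False using cp by simp
  qed
  have "(cmod (\<zeta> - 1))\<^sup>2 = (r * cos \<phi> - 1)\<^sup>2 + (r * sin \<phi>)\<^sup>2"
    unfolding z cmod_power2 by simp
  also have "\<dots> = r\<^sup>2 * ((sin \<phi>)\<^sup>2 + (cos \<phi>)\<^sup>2) - 2 * r * cos \<phi> + 1"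
    by (simp add: power2_eq_square algebra_simps del: sin_cos_squared_add sin_cos_squared_add2 sin_cos_squared_add3)
  also have "\<dots> = r\<^sup>2 - 2 * r * cos \<phi> + ((sin \<phi>)\<^sup>2 + (cos \<phi>)\<^sup>2)"
    by (simp only: sin_cos_squared_add mult_1_right)
  also have "\<dots> = (r - cos \<phi>)\<^sup>2 + (sin \<phi>)\<^sup>2"
    by (simp add: power2_diff del: sin_cos_squared_add sin_cos_squared_add2)
  finally have "(sin \<phi>)\<^sup>2 \<le> (cmod (\<zeta> - 1))\<^sup>2" by simp
  also have "\<dots> \<le> (sin \<beta>)\<^sup>2" using d by (intro power_mono) auto
  finally have "\<bar>sin \<phi>\<bar> \<le> \<bar>sin \<beta>\<bar>" by (simp add: abs_le_square_iff)
  moreover have "sin \<beta> \<ge> 0" using assms by (intro sin_ge_zero) auto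
  moreover have "\<bar>sin \<phi>\<bar> = sin \<bar>\<phi>\<bar>"
    using lt sin_ge_zero[of "\<bar>\<phi>\<bar>"] by (cases "\<phi> \<ge> 0") auto
  ultimately have s: "sin \<bar>\<phi>\<bar> \<le> sin \<beta>" by simp
  have "\<bar>\<phi>\<bar> \<le> \<beta>"
  proof (rule ccontr)
    assume "\<not> ?thesis"
    hence "sin \<beta> < sin \<bar>\<phi>\<bar>" using lt assms by (intro sin_monotone_2pi) auto
    thus False using s by simp
  qed
  thus ?thesis unfolding within_angle_def using assms(1) r0 w z by blast
qed

text \<open>
  The bound \<open>2 * pi / 3\<close> is what turns pairwise closeness into a common sector: three vectors at
  mutual angles \<open>2 * pi / 3\<close> surround the origin. Measured from one vector, all arguments \<open>\<phi> t\<close>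
  lie in \<open>[-\<alpha>, \<alpha>]\<close>, so that two of them differ by at most \<open>2 * \<alpha>\<close>; were their difference
  congruent to an angle in \<open>[-\<alpha>, \<alpha>]\<close> only after a full turn, it would be at least
  \<open>2 * pi - \<alpha> > 2 * \<alpha>\<close>. The direction \<open>u\<close> is the conjugate of the bisector of the sector.
\<close>

lemma within_angle_sector:
  assumes "finite T" "T \<noteq> {}" "0 \<le> \<alpha>" "\<alpha> < 2 * pi / 3"
    and near: "\<And>s t. s \<in> T \<Longrightarrow> t \<in> T \<Longrightarrow> within_angle \<alpha> (p s) (p t)"
  obtains u :: complex where "cmod u = 1"
    "\<And>t. t \<in> T \<Longrightarrow> cos (\<alpha> / 2) * cmod (p t) \<le> Re (u * p t)"
proof -
  obtain base where base: "base \<in> T" using assms(2) by auto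
  define q where "q = p base"
  have q: "q \<noteq> 0" using near[OF base base] unfolding within_angle_def q_def by auto
  have "\<forall>t\<in>T. \<exists>r \<phi>. r > 0 \<and> \<bar>\<phi>\<bar> \<le> \<alpha> \<and> p t = q * rcis r \<phi>"
    using near[OF base] unfolding within_angle_def q_def by blast
  then obtain r \<phi> where rp: "\<And>t. t \<in> T \<Longrightarrow> r t > 0 \<and> \<bar>\<phi> t\<bar> \<le> \<alpha> \<and> p t = q * rcis (r t) (\<phi> t)"
    by metis
  have diff: "\<bar>\<phi> t - \<phi> s\<bar> \<le> \<alpha>" if st: "s \<in> T" "t \<in> T" for s t
  proof -
    obtain R \<psi> where R: "R > 0" "\<bar>\<psi>\<bar> \<le> \<alpha>" "p t = p s * rcis R \<psi>"
      using near[OF st] unfolding within_angle_def by blast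
    have "q * rcis (r t) (\<phi> t) = q * rcis (r s * R) (\<phi> s + \<psi>)"
      using R(3) rp[OF st(1)] rp[OF st(2)] by (simp add: mult.assoc rcis_mult)
    hence eq: "rcis (r t) (\<phi> t) = rcis (r s * R) (\<phi> s + \<psi>)" using q by simp
    hence "cmod (rcis (r t) (\<phi> t)) = cmod (rcis (r s * R) (\<phi> s + \<psi>))" by simp
    hence "r t = r s * R" using rp[OF st(1)] rp[OF st(2)] R(1) by simp
    with eq rp[OF st(1)] R(1) have "cis (\<phi> t) = cis (\<phi> s + \<psi>)" by (simp add: rcis_def)
    hence "sin (\<phi> t) = sin (\<phi> s + \<psi>) \<and> cos (\<phi> t) = cos (\<phi> s + \<psi>)"
      by (simp add: complex_eq_iff)
    then obtain k :: int where k: "\<phi> t = \<phi> s + \<psi> + 2 * pi * k"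
      unfolding sin_cos_eq_iff by blast
    have b: "\<bar>\<phi> t\<bar> \<le> \<alpha>" "\<bar>\<phi> s\<bar> \<le> \<alpha>" using rp st by auto
    \<comment> \<open>No full turn fits: the three angles add up to at most \<open>3 * \<alpha> < 2 * pi\<close>.\<close>
    have "\<bar>2 * pi * k\<bar> < 2 * pi"
      using k b R(2) assms(4) by linarith
    hence "2 * pi * \<bar>real_of_int k\<bar> < 2 * pi * 1" by (simp add: abs_mult)
    hence "\<bar>real_of_int k\<bar> < 1" by simp
    hence "k = 0" by linarith
    thus ?thesis using k R(2) by simp
  qed
  define lo hi where "lo = Min (\<phi> ` T)" and "hi = Max (\<phi> ` T)"
  have "lo \<in> \<phi> ` T" "hi \<in> \<phi> ` T" using assms(1,2) unfolding lo_def hi_def by auto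
  hence lh: "hi - lo \<le> \<alpha>" using diff by fastforce
  define m where "m = (lo + hi) / 2"
  have half: "\<bar>\<phi> t - m\<bar> \<le> \<alpha> / 2" if "t \<in> T" for t
  proof -
    have "lo \<le> \<phi> t" "\<phi> t \<le> hi" using that assms(1) unfolding lo_def hi_def by auto
    thus ?thesis using lh unfolding m_def by (auto simp: abs_le_iff field_simps)
  qed
  define u where "u = cnj q / cmod q * cis (- m)"
  show ?thesis
  proof
    show "cmod u = 1" using q unfolding u_def by (simp add: norm_mult norm_divide)
    fix t assume t: "t \<in> T"
    have "cnj q * q = complex_of_real (cmod q * cmod q)"
      by (metis complex_norm_square mult.commute of_real_power power2_eq_square)
    hence "u * p t = cmod q * rcis (r t) (\<phi> t - m)"
      using rp[OF t] q unfolding u_def rcis_def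
      by (simp add: field_simps cis_mult)
    hence re: "Re (u * p t) = cmod q * r t * cos (\<phi> t - m)" by simp
    have norm: "cmod (p t) = cmod q * r t" using rp[OF t] by (simp add: norm_mult)
    have "cos (\<alpha> / 2) \<le> cos \<bar>\<phi> t - m\<bar>"
      using half[OF t] assms(3,4) by (intro cos_monotone_0_pi_le) auto
    moreover have "0 \<le> cmod q * r t" using rp[OF t] by simp
    ultimately show "cos (\<alpha> / 2) * cmod (p t) \<le> Re (u * p t)"
      unfolding re norm by (simp add: mult.commute mult_left_mono)
  qed
qed

text \<open>Project the sum onto the bisector of the common sector.\<close>

lemma norm_sum_ge_of_within_angle:
  assumes "finite T" "T \<noteq> {}" "0 \<le> \<alpha>" "\<alpha> < 2 * pi / 3"
    and "\<And>s t. s \<in> T \<Longrightarrow> t \<in> T \<Longrightarrow> within_angle \<alpha> (p s) (p t)"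
  shows "cos (\<alpha> / 2) * (\<Sum>t\<in>T. cmod (p t)) \<le> cmod (\<Sum>t\<in>T. p t)"
proof -
  obtain u :: complex where u: "cmod u = 1"
    "\<And>t. t \<in> T \<Longrightarrow> cos (\<alpha> / 2) * cmod (p t) \<le> Re (u * p t)"
    using within_angle_sector[where p = p, OF assms] by blast
  have "cos (\<alpha> / 2) * (\<Sum>t\<in>T. cmod (p t)) \<le> (\<Sum>t\<in>T. Re (u * p t))"
    unfolding sum_distrib_left using u(2) by (rule sum_mono)
  also have "\<dots> = Re (u * (\<Sum>t\<in>T. p t))" by (simp add: sum_distrib_left)
  also have "\<dots> \<le> cmod (u * (\<Sum>t\<in>T. p t))" by (rule complex_Re_le_cmod)
  finally show ?thesis using u(1) by (simp add: norm_mult)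
qed

text \<open>
  The angle \<open>\<theta> / 2\<close> and the factor \<open>cos (\<alpha> / 2)\<close> explain the shape of \<open>eta\<close>: the cosine
  compensates for the loss by cancellation in \<open>\<Sum>\<^sub>t p t\<close>, and the sine is the relative perturbation
  that turns a number by at most \<open>\<theta> / 2\<close>.
\<close>

lemma within_angle_weighted_sum:
  assumes "finite T" "T \<noteq> {}" "0 < \<theta>" "0 \<le> \<alpha>" "\<alpha> < 2 * pi / 3" "\<theta> < pi"
    and near: "\<And>s t. s \<in> T \<Longrightarrow> t \<in> T \<Longrightarrow> within_angle \<alpha> (p s) (p t)"
    and c: "\<And>t. t \<in> T \<Longrightarrow> cmod (1 - c t) \<le> sin (\<theta> / 2) * cos (\<alpha> / 2)"
  shows "within_angle (\<theta> / 2) (\<Sum>t\<in>T. p t) (\<Sum>t\<in>T. c t * p t)"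
proof -
  let ?q = "\<Sum>t\<in>T. p t"
  have ge: "cos (\<alpha> / 2) * (\<Sum>t\<in>T. cmod (p t)) \<le> cmod ?q"
    by (rule norm_sum_ge_of_within_angle[OF assms(1,2,4,5) near])
  have cpos: "cos (\<alpha> / 2) > 0" using assms(4,5) by (intro cos_gt_zero_pi) auto
  have spos: "sin (\<theta> / 2) > 0" using assms(3,6) by (intro sin_gt_zero) auto
  have "0 < (\<Sum>t\<in>T. cmod (p t))"
    using assms(1,2) near unfolding within_angle_def by (intro sum_pos) auto
  hence "0 < cos (\<alpha> / 2) * (\<Sum>t\<in>T. cmod (p t))" using cpos by simp
  hence q: "?q \<noteq> 0" using ge by auto
  have "(\<Sum>t\<in>T. c t * p t) - ?q = (\<Sum>t\<in>T. (c t - 1) * p t)"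
    by (simp add: sum_subtractf algebra_simps)
  also have "cmod \<dots> \<le> (\<Sum>t\<in>T. cmod ((c t - 1) * p t))" by (rule norm_sum)
  also have "\<dots> \<le> (\<Sum>t\<in>T. sin (\<theta> / 2) * cos (\<alpha> / 2) * cmod (p t))"
    using c by (intro sum_mono) (simp add: norm_mult norm_minus_commute mult_right_mono)
  also have "\<dots> = sin (\<theta> / 2) * (cos (\<alpha> / 2) * (\<Sum>t\<in>T. cmod (p t)))"
    by (simp add: sum_distrib_left mult.assoc)
  also have "\<dots> \<le> sin (\<theta> / 2) * cmod ?q" using ge spos by simp
  finally show ?thesis using q assms(3,6) by (intro within_angle_perturb) auto
qed

section \<open>A permanent symmetric in all coordinates\<close>

definition matchings :: "'i set \<Rightarrow> ('i \<Rightarrow> 'a set) \<Rightarrow> ('i \<Rightarrow> 'a) set set" where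
  "matchings D S = {M. M \<subseteq> PiE D S \<and> (\<forall>k\<in>D. bij_betw (\<lambda>t. t k) M (S k))}"

definition matching_sum ::
  "'i set \<Rightarrow> ('i \<Rightarrow> 'a set) \<Rightarrow> (('i \<Rightarrow> 'a) \<Rightarrow> 'b::comm_ring_1) \<Rightarrow> 'b" where
  "matching_sum D S f = (\<Sum>M\<in>matchings D S. \<Prod>t\<in>M. f t)"

definition remove_tuple :: "('i \<Rightarrow> 'a set) \<Rightarrow> ('i \<Rightarrow> 'a) \<Rightarrow> 'i \<Rightarrow> 'a set" where
  "remove_tuple S t = (\<lambda>j. S j - {t j})"

lemma finite_matchings:
  assumes "finite D" "\<And>k. k \<in> D \<Longrightarrow> finite (S k)"
  shows "finite (matchings D S)"
  by (rule finite_subset[of _ "Pow (PiE D S)"]) (auto simp: matchings_def assms finite_PiE)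

lemma finite_matching:
  assumes "k \<in> D" "finite (S k)" "M \<in> matchings D S"
  shows "finite M"
  using assms bij_betw_finite unfolding matchings_def by blast

lemma insert_matching:
  assumes "t \<in> PiE D S" "M \<in> matchings D (remove_tuple S t)"
  shows "insert t M \<in> matchings D S"
  unfolding matchings_def
proof (intro CollectI conjI ballI)
  have sub: "M \<subseteq> PiE D (remove_tuple S t)" using assms(2) by (auto simp: matchings_def)
  also have "\<dots> \<subseteq> PiE D S" by (rule PiE_mono) (auto simp: remove_tuple_def)
  finally show "insert t M \<subseteq> PiE D S" using assms(1) by auto
  fix k assume k: "k \<in> D"
  have b: "bij_betw (\<lambda>t. t k) M (S k - {t k})"
    using assms(2) k by (auto simp: matchings_def remove_tuple_def)
  have "t k \<in> S k" using assms(1) k by auto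
  hence eq: "insert (t k) (S k - {t k}) = S k" by auto
  show "bij_betw (\<lambda>t. t k) (insert t M) (S k)"
  proof -
    have img: "(\<lambda>t. t k) ` M = S k - {t k}" using b by (simp add: bij_betw_def)
    hence "t k \<notin> (\<lambda>t. t k) ` (M - {t})" by blast
    hence "inj_on (\<lambda>t. t k) (insert t M)" using b by (simp add: bij_betw_def)
    moreover have "(\<lambda>t. t k) ` insert t M = S k" unfolding image_insert img by (rule eq)
    ultimately show ?thesis by (simp only: bij_betw_def)
  qed
qed

lemma remove_matching:
  assumes "M \<in> matchings D S" "t \<in> M"
  shows "M - {t} \<in> matchings D (remove_tuple S t)"
  unfolding matchings_def
proof (intro CollectI conjI ballI)
  have sub: "M \<subseteq> PiE D S" and bij: "\<And>k. k \<in> D \<Longrightarrow> bij_betw (\<lambda>t. t k) M (S k)"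
    using assms by (auto simp: matchings_def)
  show "M - {t} \<subseteq> PiE D (remove_tuple S t)"
  proof
    fix s assume s: "s \<in> M - {t}"
    have "s k \<noteq> t k" if "k \<in> D" for k
      using bij[OF that] s assms(2) unfolding bij_betw_def inj_on_def by auto
    thus "s \<in> PiE D (remove_tuple S t)"
      using s sub by (auto simp: PiE_iff remove_tuple_def)
  qed
  fix k assume k: "k \<in> D"
  show "bij_betw (\<lambda>t. t k) (M - {t}) (remove_tuple S t k)"
    unfolding remove_tuple_def using bij_betw_DiffI[OF bij[OF k], of "{t}" "{t k}"] assms(2) bij[OF k]
    by (auto simp: bij_betw_def)
qed

text \<open>
  Laplace expansion along the slice of coordinate \<open>k\<close> at \<open>a\<close>: a matching contains exactly one tuple
  \<open>t\<close> with \<open>t k = a\<close>, and the rest of it is a matching of the index sets without the entries of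
  \<open>t\<close>.
\<close>

lemma matching_sum_expand:
  assumes "finite D" "\<And>k. k \<in> D \<Longrightarrow> finite (S k)" "k \<in> D" "a \<in> S k"
  shows "matching_sum D S f =
    (\<Sum>t\<in>{t \<in> PiE D S. t k = a}. f t * matching_sum D (remove_tuple S t) f)"
proof -
  let ?T = "{t \<in> PiE D S. t k = a}"
  let ?X = "Sigma ?T (\<lambda>t. matchings D (remove_tuple S t))"
  have finT: "finite ?T" using finite_PiE[OF assms(1,2)] by simp
  have fin: "finite (matchings D (remove_tuple S t))" for t
    using assms by (intro finite_matchings) (auto simp: remove_tuple_def)
  have away: "s k \<noteq> a" if "t \<in> ?T" "M \<in> matchings D (remove_tuple S t)" "s \<in> M" for s t M
    using that assms(3) by (auto simp: matchings_def remove_tuple_def PiE_iff subset_iff)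
  have bij: "bij_betw (\<lambda>(t, M). insert t M) ?X (matchings D S)"
    unfolding bij_betw_def
  proof (intro conjI subset_antisym subsetI)
    show "inj_on (\<lambda>(t, M). insert t M) ?X"
    proof (rule inj_onI, clarify)
      fix t M s N
      assume a: "t \<in> PiE D S" "a = t k" "M \<in> matchings D (remove_tuple S t)" "s \<in> PiE D S" "s k = t k"
        "N \<in> matchings D (remove_tuple S s)" "insert t M = insert s N"
      have nM: "x k \<noteq> t k" if "x \<in> M" for x using away[of t M x] a that by auto
      have nN: "x k \<noteq> t k" if "x \<in> N" for x using away[of s N x] a that by auto
      have "t = s" using a(5,7) nM nN by (metis insert_iff)
      moreover have "t \<notin> M" "s \<notin> N" using nM nN a(5) by auto
      ultimately show "t = s \<and> M = N" using a(7) by (metis insert_ident)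
    qed
  next
    fix M assume "M \<in> (\<lambda>(t, M). insert t M) ` ?X"
    thus "M \<in> matchings D S" using insert_matching by fastforce
  next
    fix M assume M: "M \<in> matchings D S"
    hence "a \<in> (\<lambda>t. t k) ` M" using assms(3,4) by (auto simp: matchings_def bij_betw_def)
    then obtain t where t: "t \<in> M" "t k = a" by auto
    hence "t \<in> ?T" using M by (auto simp: matchings_def)
    moreover have "M = insert t (M - {t})" using t by auto
    ultimately show "M \<in> (\<lambda>(t, M). insert t M) ` ?X"
      using remove_matching[OF M t(1)] by (intro image_eqI[of _ _ "(t, M - {t})"]) auto
  qed
  have "matching_sum D S f = (\<Sum>(t, M)\<in>?X. prod f (insert t M))"
    unfolding matching_sum_def
    by (subst sum.reindex_bij_betw[OF bij, symmetric]) (simp add: case_prod_unfold)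
  also have "\<dots> = (\<Sum>(t, M)\<in>?X. f t * prod f M)"
  proof (intro sum.cong refl, clarify)
    fix t M assume a: "t \<in> PiE D S" "a = t k" "M \<in> matchings D (remove_tuple S t)"
    have "finite M" using finite_matching[OF assms(3) _ a(3)] assms(2,3) by (simp add: remove_tuple_def)
    moreover have "t \<notin> M" using away[of t M t] a by auto
    ultimately show "prod f (insert t M) = f t * prod f M" by simp
  qed
  also have "\<dots> = (\<Sum>t\<in>?T. \<Sum>M\<in>matchings D (remove_tuple S t). f t * prod f M)"
    using finT fin by (subst sum.Sigma) auto
  finally show ?thesis by (simp add: matching_sum_def sum_distrib_left)
qed

text \<open>
  Expanding along the new index \<open>b\<close> after the exchange gives the minors of the expansion along
  \<open>a\<close> before it, because deleting \<open>b\<close> from the new index set leaves what deleting \<open>a\<close> leaves of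
  the old one. Only the coefficients change.
\<close>

lemma matching_sum_exchange_expand:
  assumes "finite D" "\<And>k. k \<in> D \<Longrightarrow> finite (S k)" "k \<in> D" "a \<in> S k" "b \<notin> S k"
  shows "matching_sum D (S(k := insert b (S k - {a}))) f =
    (\<Sum>t\<in>{t \<in> PiE D S. t k = a}. f (t(k := b)) * matching_sum D (remove_tuple S t) f)"
proof -
  let ?S = "S(k := insert b (S k - {a}))"
  let ?T = "{t \<in> PiE D S. t k = a}" and ?T' = "{t \<in> PiE D ?S. t k = b}"
  have bij: "bij_betw (\<lambda>t. t(k := b)) ?T ?T'"
  proof (rule bij_betw_byWitness[where f' = "\<lambda>t. t(k := a)"])
    show "\<forall>t\<in>?T. (t(k := b))(k := a) = t" "\<forall>t\<in>?T'. (t(k := a))(k := b) = t"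
      by (simp_all only: fun_upd_upd fun_upd_idem_iff mem_Collect_eq ball_simps) blast+
    have "t(k := b) \<in> PiE D ?S" if "t \<in> PiE D S" for t
    proof (rule PiE_I)
      fix j assume "j \<in> D"
      thus "(t(k := b)) j \<in> ?S j" using PiE_mem[OF that, of j] by (cases "j = k") simp_all
    next
      fix j assume "j \<notin> D"
      thus "(t(k := b)) j = undefined" using PiE_arb[OF that, of j] assms(3) by (cases "j = k") simp_all
    qed
    thus "(\<lambda>t. t(k := b)) ` ?T \<subseteq> ?T'" by (intro image_subsetI CollectI) simp_all
    have "t(k := a) \<in> PiE D S" if "t \<in> PiE D ?S" for t
    proof (rule PiE_I)
      fix j assume "j \<in> D"
      thus "(t(k := a)) j \<in> S j" using PiE_mem[OF that, of j] assms(4) by (cases "j = k") simp_all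
    next
      fix j assume "j \<notin> D"
      thus "(t(k := a)) j = undefined" using PiE_arb[OF that, of j] assms(3) by (cases "j = k") simp_all
    qed
    thus "(\<lambda>t. t(k := a)) ` ?T' \<subseteq> ?T" by (intro image_subsetI CollectI) simp_all
  qed
  have "matching_sum D ?S f = (\<Sum>t\<in>?T'. f t * matching_sum D (remove_tuple ?S t) f)"
    using assms by (intro matching_sum_expand) auto
  also have "\<dots> = (\<Sum>t\<in>?T. f (t(k := b)) * matching_sum D (remove_tuple ?S (t(k := b))) f)"
    by (rule sum.reindex_bij_betw[OF bij, symmetric])
  also have "\<dots> = (\<Sum>t\<in>?T. f (t(k := b)) * matching_sum D (remove_tuple S t) f)"
  proof (rule sum.cong[OF refl])
    fix t assume "t \<in> ?T"
    hence "remove_tuple ?S (t(k := b)) = remove_tuple S t"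
      using assms(5) by (auto simp: remove_tuple_def fun_eq_iff)
    thus "f (t(k := b)) * matching_sum D (remove_tuple ?S (t(k := b))) f =
      f (t(k := b)) * matching_sum D (remove_tuple S t) f" by simp
  qed
  finally show ?thesis .
qed

section \<open>Exchanging one index rotates the permanent by a small angle\<close>

lemma matching_sum_empty:
  assumes "D \<noteq> {}" "\<And>k. k \<in> D \<Longrightarrow> S k = {}"
  shows "matching_sum D S f = 1"
proof -
  obtain k where k: "k \<in> D" using assms(1) by auto
  have "M = {}" if "M \<in> matchings D S" for M
    using that k assms(2)[OF k] by (auto simp: matchings_def bij_betw_def)
  moreover have "{} \<in> matchings D S"
    using assms(2) by (simp add: matchings_def bij_betw_def)
  ultimately have "matchings D S = {{}}" by blast
  thus ?thesis by (simp add: matching_sum_def)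
qed

text \<open>
  The induction hypothesis for index sets of size \<open>n\<close>. It ranges over all families \<open>S\<close>, since the
  minors that occur in one expansion live on different index sets.
\<close>

definition exchange_stable ::
  "real \<Rightarrow> 'i set \<Rightarrow> (('i \<Rightarrow> 'a) \<Rightarrow> complex) \<Rightarrow> nat \<Rightarrow> bool" where
  "exchange_stable \<theta> D f n \<longleftrightarrow>
    (\<forall>S. (\<forall>k\<in>D. finite (S k) \<and> card (S k) = n) \<longrightarrow>
      matching_sum D S f \<noteq> 0 \<and>
      (\<forall>k\<in>D. \<forall>a\<in>S k. \<forall>b. b \<notin> S k \<longrightarrow>
        within_angle \<theta> (matching_sum D S f) (matching_sum D (S(k := insert b (S k - {a}))) f)))"

text \<open>
  Moving from \<open>u\<close> to \<open>v\<close> in one coordinate \<open>j\<close> changes only the \<open>j\<close>-th index set of the minor: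
  the index \<open>v j\<close> leaves it and \<open>u j\<close> comes back. This is one exchange and costs one \<open>\<theta>\<close>, so the
  coordinates in \<open>J\<close> are switched one at a time.
\<close>

lemma minors_within_angle_override:
  fixes \<theta> :: real
  assumes st: "exchange_stable \<theta> D f n" and "0 \<le> \<theta>"
    and S: "\<And>k. k \<in> D \<Longrightarrow> finite (S k) \<and> card (S k) = Suc n"
    and u: "u \<in> PiE D S" and v: "v \<in> PiE D S"
    and J: "finite J" "J \<subseteq> D"
  shows "within_angle (card J * \<theta>) (matching_sum D (remove_tuple S u) f)
           (matching_sum D (remove_tuple S (override_on u v J)) f)"
  using J
proof (induction rule: finite_induct)
  case empty
  have "\<forall>k\<in>D. finite (remove_tuple S u k) \<and> card (remove_tuple S u k) = n"
    using S u by (auto simp: remove_tuple_def PiE_iff)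
  hence "matching_sum D (remove_tuple S u) f \<noteq> 0"
    using st unfolding exchange_stable_def by blast
  thus ?case by (simp add: within_angle_refl)
next
  case (insert j J)
  let ?w = "override_on u v J"
  let ?R = "remove_tuple S ?w"
  have j: "j \<in> D" using insert by auto
  have w: "?w \<in> PiE D S"
    using u v by (auto simp: PiE_iff override_on_def extensional_def)
  have card: "\<forall>k\<in>D. finite (?R k) \<and> card (?R k) = n"
    using S w by (auto simp: remove_tuple_def PiE_iff)
  have upd: "override_on u v (insert j J) = ?w(j := v j)"
    by (auto simp: override_on_def fun_eq_iff)
  have step: "within_angle \<theta> (matching_sum D ?R f) (matching_sum D (remove_tuple S (?w(j := v j))) f)"
  proof (cases "?w j = v j")
    case True
    hence "?w(j := v j) = ?w" by (metis fun_upd_triv)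
    thus ?thesis using st card assms(2) unfolding exchange_stable_def
      by (metis within_angle_refl)
  next
    case False
    have "v j \<in> ?R j" "?w j \<notin> ?R j"
      using False v j by (auto simp: remove_tuple_def PiE_iff)
    hence "within_angle \<theta> (matching_sum D ?R f)
        (matching_sum D (?R(j := insert (?w j) (?R j - {v j}))) f)"
      using st card j unfolding exchange_stable_def by blast
    moreover have "?w j \<in> S j" using w j by auto
    hence "?R(j := insert (?w j) (?R j - {v j})) = remove_tuple S (?w(j := v j))"
      using False by (auto simp: remove_tuple_def fun_eq_iff)
    ultimately show ?thesis by simp
  qed
  have "within_angle (card J * \<theta>) (matching_sum D (remove_tuple S u) f) (matching_sum D ?R f)"
    using insert by auto
  from within_angle_trans[OF this step] show ?case
    unfolding upd using insert(1,2) by (simp add: algebra_simps fun_upd_def)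
qed

lemma minors_within_angle:
  fixes \<theta> :: real
  assumes "exchange_stable \<theta> D f n" "0 \<le> \<theta>"
    and "\<And>k. k \<in> D \<Longrightarrow> finite (S k) \<and> card (S k) = Suc n"
    and "finite D" "k \<in> D" "u \<in> PiE D S" "v \<in> PiE D S" "u k = v k"
  shows "within_angle ((real (card D) - 1) * \<theta>) (matching_sum D (remove_tuple S u) f)
           (matching_sum D (remove_tuple S v) f)"
proof -
  have "within_angle (card (D - {k}) * \<theta>) (matching_sum D (remove_tuple S u) f)
           (matching_sum D (remove_tuple S (override_on u v (D - {k}))) f)"
    using assms by (intro minors_within_angle_override) auto
  moreover have "override_on u v (D - {k}) = v"
    using assms(6-8) by (auto simp: override_on_def fun_eq_iff PiE_iff extensional_def)
  moreover have "real (card (D - {k})) = real (card D) - 1"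
    using assms(4,5) by (metis card_Suc_Diff1 add_diff_cancel_right' of_nat_Suc add.commute)
  ultimately show ?thesis by simp
qed

lemma exchange_stable_if_near_one:
  fixes f :: "('i \<Rightarrow> 'a) \<Rightarrow> complex"
  assumes D: "finite D" "D \<noteq> {}"
    and th: "0 < \<theta>" "\<theta> < pi" "(real (card D) - 1) * \<theta> < 2 * pi / 3"
    and f: "\<And>t. cmod (1 - f t) \<le> eta (card D) \<theta>"
  shows "exchange_stable \<theta> D f n"
proof (induction n)
  case 0
  have "matching_sum D S f \<noteq> 0 \<and> (\<forall>k\<in>D. S k = {})" if "\<forall>k\<in>D. finite (S k) \<and> card (S k) = 0" for S
  proof -
    have "\<forall>k\<in>D. S k = {}" using that card_0_eq by blast
    thus ?thesis using matching_sum_empty[of D S f] D(2) by simp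
  qed
  thus ?case unfolding exchange_stable_def by blast
next
  case (Suc n)
  let ?\<alpha> = "(real (card D) - 1) * \<theta>"
  have "real (card D) \<ge> 1" using D by (simp add: Suc_leI card_gt_0_iff)
  hence \<alpha>: "0 \<le> ?\<alpha>" using th by simp
  show ?case unfolding exchange_stable_def
  proof (intro allI impI)
    fix S :: "'i \<Rightarrow> 'a set"
    assume S: "\<forall>k\<in>D. finite (S k) \<and> card (S k) = Suc n"
    have fin: "\<And>k. k \<in> D \<Longrightarrow> finite (S k)" using S by auto
    have near: "within_angle (\<theta> / 2) (\<Sum>t\<in>{t \<in> PiE D S. t k = a}. matching_sum D (remove_tuple S t) f)
        (\<Sum>t\<in>{t \<in> PiE D S. t k = a}. c t * matching_sum D (remove_tuple S t) f)"
      if k: "k \<in> D" "a \<in> S k" and c: "\<And>t. cmod (1 - c t) \<le> eta (card D) \<theta>" for k a c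
    proof (rule within_angle_weighted_sum[where \<alpha> = ?\<alpha>])
      show "finite {t \<in> PiE D S. t k = a}" using finite_PiE[OF D(1) fin] by simp
      have "PiE D S \<noteq> {}" using S by (auto simp: PiE_eq_empty_iff)
      then obtain t where "t \<in> PiE D S" by auto
      hence "t(k := a) \<in> {t \<in> PiE D S. t k = a}"
        using k by (auto simp: PiE_iff extensional_def)
      thus "{t \<in> PiE D S. t k = a} \<noteq> {}" by blast
      show "within_angle ?\<alpha> (matching_sum D (remove_tuple S s) f) (matching_sum D (remove_tuple S t) f)"
        if "s \<in> {t \<in> PiE D S. t k = a}" "t \<in> {t \<in> PiE D S. t k = a}" for s t
        using that S th(1) D(1) k(1) by (intro minors_within_angle[OF Suc]) auto
      show "cmod (1 - c t) \<le> sin (\<theta> / 2) * cos (?\<alpha> / 2)" for t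
        using c[of t] by (simp add: eta_def)
    qed (use th \<alpha> in auto)
    have exp: "matching_sum D S f = (\<Sum>t\<in>{t \<in> PiE D S. t k = a}. f t * matching_sum D (remove_tuple S t) f)"
      if "k \<in> D" "a \<in> S k" for k a
      by (rule matching_sum_expand) (use that D(1) fin in auto)
    obtain k where k: "k \<in> D" using D by auto
    have "S k \<noteq> {}" using S k by auto
    then obtain a where a: "a \<in> S k" by auto
    show "matching_sum D S f \<noteq> 0 \<and> (\<forall>k\<in>D. \<forall>a\<in>S k. \<forall>b. b \<notin> S k \<longrightarrow>
        within_angle \<theta> (matching_sum D S f) (matching_sum D (S(k := insert b (S k - {a}))) f))"
    proof (intro conjI ballI allI impI)
      show "matching_sum D S f \<noteq> 0"
        using within_angle_nonzero[OF near[OF k a f]] exp[OF k a] by simp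
      fix k a b assume k: "k \<in> D" "a \<in> S k" "b \<notin> S k"
      have ex: "matching_sum D (S(k := insert b (S k - {a}))) f =
          (\<Sum>t\<in>{t \<in> PiE D S. t k = a}. f (t(k := b)) * matching_sum D (remove_tuple S t) f)"
        by (rule matching_sum_exchange_expand) (use k D(1) fin in auto)
      have "within_angle (\<theta> / 2 + \<theta> / 2) (matching_sum D S f) (matching_sum D (S(k := insert b (S k - {a}))) f)"
        unfolding ex exp[OF k(1,2)]
        by (rule within_angle_trans[OF within_angle_sym near]) (use near k f in auto)
      thus "within_angle \<theta> (matching_sum D S f) (matching_sum D (S(k := insert b (S k - {a}))) f)"
        by simp
    qed
  qed
qed

section \<open>The permanent of an array as a sum over matchings\<close>

text \<open>
  The graph of a family of permutations, \<open>{(i, \<sigma>\<^sub>2 i, \<dots>, \<sigma>\<^sub>d i)}\<close>, is a matching, and it determines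
  the family. The tuples are extensional on \<open>{1..d}\<close>, so that they are elements of the product
  \<open>PiE\<close>.
\<close>

definition graph_tuple :: "nat \<Rightarrow> (nat \<Rightarrow> nat \<Rightarrow> nat) \<Rightarrow> nat \<Rightarrow> nat \<Rightarrow> nat" where
  "graph_tuple d \<sigma> i = (\<lambda>k\<in>{1..d}. if k = 1 then i else \<sigma> k i)"

lemma bij_betw_graph_tuples:
  assumes "d \<ge> 1"
  shows "bij_betw (\<lambda>\<sigma>. graph_tuple d \<sigma> ` {1..n}) ({2..d} \<rightarrow>\<^sub>E {p. p permutes {1..n}})
           (matchings {1..d} (\<lambda>_. {1..n}))"
  unfolding bij_betw_def
proof (intro conjI subset_antisym subsetI)
  show "inj_on (\<lambda>\<sigma>. graph_tuple d \<sigma> ` {1..n}) ({2..d} \<rightarrow>\<^sub>E {p. p permutes {1..n}})"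
  proof (rule inj_onI)
    fix \<sigma> \<tau> assume s: "\<sigma> \<in> {2..d} \<rightarrow>\<^sub>E {p. p permutes {1..n}}" and t: "\<tau> \<in> {2..d} \<rightarrow>\<^sub>E {p. p permutes {1..n}}"
      and eq: "graph_tuple d \<sigma> ` {1..n} = graph_tuple d \<tau> ` {1..n}"
    show "\<sigma> = \<tau>"
    proof (rule PiE_ext[OF s t])
      fix k assume k: "k \<in> {2..d}"
      have pk: "\<sigma> k permutes {1..n}" "\<tau> k permutes {1..n}" using s t k by auto
      show "\<sigma> k = \<tau> k"
      proof
        fix i
        show "\<sigma> k i = \<tau> k i"
        proof (cases "i \<in> {1..n}")
          case True
          then obtain j where j: "graph_tuple d \<sigma> i = graph_tuple d \<tau> j" using eq by blast
          from fun_cong[OF j, of 1] assms have "i = j" by (simp add: graph_tuple_def)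
          with fun_cong[OF j, of k] k show ?thesis by (simp add: graph_tuple_def)
        next
          case False
          thus ?thesis using pk by (metis permutes_not_in)
        qed
      qed
    qed
  qed
next
  fix M assume "M \<in> (\<lambda>\<sigma>. graph_tuple d \<sigma> ` {1..n}) ` ({2..d} \<rightarrow>\<^sub>E {p. p permutes {1..n}})"
  then obtain \<sigma> where s: "\<sigma> \<in> {2..d} \<rightarrow>\<^sub>E {p. p permutes {1..n}}" and M: "M = graph_tuple d \<sigma> ` {1..n}"
    by auto
  have bij: "bij_betw (\<lambda>i. graph_tuple d \<sigma> i k) {1..n} {1..n}" if k: "k \<in> {1..d}" for k
  proof (cases "k = 1")
    case True
    have "bij_betw (\<lambda>i. graph_tuple d \<sigma> i k) {1..n} {1..n} \<longleftrightarrow> bij_betw id {1..n} {1..n}"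
      by (rule bij_betw_cong) (use k True in \<open>auto simp: graph_tuple_def\<close>)
    thus ?thesis by simp
  next
    case False
    hence "\<sigma> k permutes {1..n}" using s k by (auto simp: PiE_iff)
    moreover have "(\<lambda>i. graph_tuple d \<sigma> i k) = \<sigma> k"
      using k False by (auto simp: graph_tuple_def fun_eq_iff)
    ultimately show ?thesis by (simp add: permutes_imp_bij)
  qed
  have "graph_tuple d \<sigma> i \<in> {1..d} \<rightarrow>\<^sub>E {1..n}" if "i \<in> {1..n}" for i
  proof (rule PiE_I)
    show "graph_tuple d \<sigma> i k \<in> {1..n}" if "k \<in> {1..d}" for k
      using bij_betwE[OF bij[OF that]] \<open>i \<in> {1..n}\<close> by blast
  qed (simp only: graph_tuple_def restrict_apply if_False)
  moreover have "bij_betw (\<lambda>t. t k) (graph_tuple d \<sigma> ` {1..n}) {1..n}" if "k \<in> {1..d}" for k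
  proof -
    have "inj_on ((\<lambda>t. t k) \<circ> graph_tuple d \<sigma>) {1..n}"
      using bij[OF that] by (simp add: bij_betw_def comp_def)
    thus ?thesis using bij[OF that] by (simp add: bij_betw_def inj_on_imageI image_image)
  qed
  ultimately show "M \<in> matchings {1..d} (\<lambda>_. {1..n})"
    unfolding matchings_def M by blast
next
  fix M assume M: "M \<in> matchings {1..d} (\<lambda>_. {1..n})"
  have sub: "M \<subseteq> {1..d} \<rightarrow>\<^sub>E {1..n}" and bij: "\<And>k. k \<in> {1..d} \<Longrightarrow> bij_betw (\<lambda>t. t k) M {1..n}"
    using M by (auto simp: matchings_def)
  \<comment> \<open>\<open>h i\<close> is the tuple of \<open>M\<close> with first coordinate \<open>i\<close>; its other coordinates are the values
    of the permutations at \<open>i\<close>, extended by the identity outside \<open>{1..n}\<close>.\<close>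
  define h where "h = inv_into M (\<lambda>t. t 1)"
  have b1: "bij_betw (\<lambda>t. t 1) M {1..n}" using bij assms by simp
  have h: "bij_betw h {1..n} M" unfolding h_def by (rule bij_betw_inv_into[OF b1])
  have h1: "h i 1 = i" if "i \<in> {1..n}" for i
    unfolding h_def by (rule bij_betw_inv_into_right[OF b1 that])
  define \<sigma> where "\<sigma> = (\<lambda>k\<in>{2..d}. \<lambda>i. if i \<in> {1..n} then h i k else i)"
  have "\<sigma> k permutes {1..n}" if k: "k \<in> {2..d}" for k
  proof (rule bij_imp_permutes)
    have "bij_betw ((\<lambda>t. t k) \<circ> h) {1..n} {1..n}"
      using bij_betw_trans[OF h bij[of k]] k by simp
    thus "bij_betw (\<sigma> k) {1..n} {1..n}"
      by (rule bij_betw_cong[THEN iffD1, rotated]) (use k in \<open>auto simp: \<sigma>_def\<close>)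
    show "\<sigma> k x = x" if "x \<notin> {1..n}" for x using k that by (auto simp: \<sigma>_def)
  qed
  hence s: "\<sigma> \<in> {2..d} \<rightarrow>\<^sub>E {p. p permutes {1..n}}"
    by (auto simp: PiE_iff \<sigma>_def)
  have "graph_tuple d \<sigma> i = h i" if i: "i \<in> {1..n}" for i
  proof
    fix k
    have "h i \<in> {1..d} \<rightarrow>\<^sub>E {1..n}" using bij_betwE[OF h] i sub by blast
    thus "graph_tuple d \<sigma> i k = h i k"
      using h1[OF i] i by (auto simp: graph_tuple_def \<sigma>_def PiE_iff extensional_def)
  qed
  hence "graph_tuple d \<sigma> ` {1..n} = h ` {1..n}" by (intro image_cong) auto
  also have "\<dots> = M" using h by (simp add: bij_betw_def)
  finally show "M \<in> (\<lambda>\<sigma>. graph_tuple d \<sigma> ` {1..n}) ` ({2..d} \<rightarrow>\<^sub>E {p. p permutes {1..n}})"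
    using s by blast
qed

lemma PER_eq_matching_sum:
  assumes "d \<ge> 1"
  shows "PER d n A = matching_sum {1..d} (\<lambda>_. {1..n}) (\<lambda>t. A (map t [1..<Suc d]))"
proof -
  have "matching_sum {1..d} (\<lambda>_. {1..n}) (\<lambda>t. A (map t [1..<Suc d])) =
    (\<Sum>\<sigma>\<in>{2..d} \<rightarrow>\<^sub>E {p. p permutes {1..n}}. \<Prod>t\<in>graph_tuple d \<sigma> ` {1..n}. A (map t [1..<Suc d]))"
    unfolding matching_sum_def by (rule sum.reindex_bij_betw[OF bij_betw_graph_tuples[OF assms], symmetric])
  also have "\<dots> = PER d n A"
    unfolding PER_def
  proof (rule sum.cong[OF refl])
    fix \<sigma> assume "\<sigma> \<in> {2..d} \<rightarrow>\<^sub>E {p. p permutes {1..n}}"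
    have inj: "inj_on (graph_tuple d \<sigma>) {1..n}"
    proof (rule inj_onI)
      fix i j assume "graph_tuple d \<sigma> i = graph_tuple d \<sigma> j"
      from fun_cong[OF this, of 1] assms show "i = j" by (simp add: graph_tuple_def)
    qed
    have "[1..<Suc d] = 1 # [2..<Suc d]"
      using assms by (subst upt_conv_Cons) (auto simp: numeral_2_eq_2)
    hence "map (graph_tuple d \<sigma> i) [1..<Suc d] = i # map (\<lambda>k. \<sigma> k i) [2..<Suc d]" for i
      using assms by (auto simp: graph_tuple_def simp del: upt_Suc)
    thus "(\<Prod>t\<in>graph_tuple d \<sigma> ` {1..n}. A (map t [1..<Suc d])) =
        (\<Prod>i = 1..n. A (i # map (\<lambda>k. \<sigma> k i) [2..<Suc d]))"
      by (subst prod.reindex[OF inj]) (simp del: upt_Suc)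
  qed
  finally show ?thesis by simp
qed

lemma matching_sum_cong:
  assumes "\<And>t. t \<in> PiE D S \<Longrightarrow> f t = g t"
  shows "matching_sum D S f = matching_sum D S g"
  unfolding matching_sum_def
  by (intro sum.cong prod.cong refl) (use assms in \<open>auto simp: matchings_def\<close>)

lemma theta_less_two_thirds_pi:
  fixes \<theta> :: real
  assumes "2 \<le> d" "0 < \<theta>" "(real d - 1) * \<theta> < 2 * pi / 3"
  shows "\<theta> < 2 * pi / 3"
proof -
  have "1 * \<theta> \<le> (real d - 1) * \<theta>" using assms by (intro mult_right_mono) auto
  thus ?thesis using assms(3) by simp
qed

lemma eta_bounds:
  assumes d: "2 \<le> d" and th: "0 < \<theta>" "(real d - 1) * \<theta> < 2 * pi / 3"
  shows "0 < eta d \<theta>" "eta d \<theta> < 1"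
proof -
  let ?x = "(real d - 1) * \<theta> / 2"
  have x: "0 < ?x" "?x < pi / 3" using d th by auto
  have s: "0 < sin (\<theta> / 2)"
    using th theta_less_two_thirds_pi[OF d th] by (intro sin_gt_zero) auto
  have "0 < cos ?x" using x by (intro cos_gt_zero_pi) auto
  thus "0 < eta d \<theta>" using s by (simp add: eta_def)
  have "cos ?x < cos 0" using x by (intro cos_monotone_0_pi) auto
  hence "sin (\<theta> / 2) * cos ?x < sin (\<theta> / 2) * 1" using s by (intro mult_strict_left_mono) auto
  also have "\<dots> \<le> 1" by simp
  finally show "eta d \<theta> < 1" by (simp add: eta_def)
qed

lemma PER_nonzero:
  assumes d: "2 \<le> d" and th: "0 < \<theta>" "(real d - 1) * \<theta> < 2 * pi / 3"
    and Z: "\<And>js. js \<in> tensor_indices d n \<Longrightarrow> cmod (1 - Z js) \<le> eta d \<theta>"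
  shows "PER d n Z \<noteq> 0"
proof -
  let ?P = "{1..d} \<rightarrow>\<^sub>E {1..n}"
  \<comment> \<open>The array is continued by the constant \<open>1\<close>, so that the bound on the entries holds at every
    tuple, in particular at those with an exchanged index.\<close>
  define f where "f t = (if t \<in> ?P then Z (map t [1..<Suc d]) else 1)" for t
  have "cmod (1 - f t) \<le> eta (card {1..d}) \<theta>" for t
  proof (cases "t \<in> ?P")
    case True
    hence "map t [1..<Suc d] \<in> tensor_indices d n"
      by (auto simp: tensor_indices_def PiE_iff)
    thus ?thesis using Z True by (simp add: f_def del: upt_Suc)
  qed (use eta_bounds(1)[OF d th] in \<open>simp add: f_def\<close>)
  hence "exchange_stable \<theta> {1..d} f n"
    using d th theta_less_two_thirds_pi[OF d th] pi_gt_zero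
    by (intro exchange_stable_if_near_one) (auto simp del: pi_gt_zero)
  hence "matching_sum {1..d} (\<lambda>_. {1..n}) f \<noteq> 0"
    unfolding exchange_stable_def by auto
  moreover have "PER d n Z = matching_sum {1..d} (\<lambda>_. {1..n}) f"
    using d by (subst PER_eq_matching_sum) (auto intro!: matching_sum_cong simp: f_def simp del: upt_Suc)
  ultimately show ?thesis by simp
qed

section \<open>The size of the radius\<close>

text \<open>
  With \<open>s = sin (\<theta> / 2)\<close>, the radius is \<open>s * sqrt (1 - s\<^sup>2)\<close> for \<open>d = 2\<close>, \<open>s * (1 - 2 * s\<^sup>2)\<close> for
  \<open>d = 3\<close> and \<open>s * sqrt (1 - s\<^sup>2) * (1 - 4 * s\<^sup>2)\<close> for \<open>d = 4\<close>. The first two are largest at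
  \<open>s\<^sup>2 = 1 / 2\<close> and \<open>s\<^sup>2 = 1 / 6\<close>. For \<open>d = 4\<close>, \<open>s = 7 / 25\<close> is close to the maximum, and the
  Pythagorean triple \<open>7, 24, 25\<close> makes the value rational. For larger \<open>d\<close> the choice
  \<open>\<theta> = 1 / (d - 1)\<close> keeps the cosine factor constant, while the sine factor is of order \<open>1 / d\<close>.
\<close>

lemma arcsin_lt_pi_sixth:
  assumes "0 \<le> s" "s < 1 / 2"
  shows "arcsin s < pi / 6"
proof -
  have "arcsin s < arcsin (1 / 2)" using assms by (intro arcsin_less_arcsin) auto
  also have "arcsin (1 / 2) = pi / 6"
    using arcsin_sin[of "pi / 6"] by (simp add: sin_30)
  finally show ?thesis .
qed

lemma eta_3_value:
  defines "\<theta> \<equiv> 2 * arcsin (1 / sqrt 6)"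
  shows "0 < \<theta>" "(real 3 - 1) * \<theta> < 2 * pi / 3" "eta 3 \<theta> = sqrt 6 / 9"
proof -
  have "sqrt 6 > 2" by (rule real_less_rsqrt) simp
  hence s: "0 < 1 / sqrt 6" "1 / sqrt 6 < 1 / 2" by (auto simp: field_simps)
  show "0 < \<theta>" using s arcsin_less_arcsin[of 0 "1 / sqrt 6"] by (simp add: \<theta>_def)
  show "(real 3 - 1) * \<theta> < 2 * pi / 3" using arcsin_lt_pi_sixth[of "1 / sqrt 6"] s by (simp add: \<theta>_def)
  have si: "sin (\<theta> / 2) = 1 / sqrt 6"
    unfolding \<theta>_def nonzero_mult_div_cancel_left[OF zero_neq_numeral[symmetric]]
    by (rule sin_arcsin) (use s in linarith)+
  have "cos (2 * (\<theta> / 2)) = 1 - 2 * (sin (\<theta> / 2))\<^sup>2" by (rule cos_double_sin)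
  also have "\<dots> = 2 / 3" by (simp add: si power_divide)
  finally have co: "cos (2 * (\<theta> / 2)) = 2 / 3" .
  have "(real 3 - 1) * \<theta> / 2 = 2 * (\<theta> / 2)" by simp
  hence "eta 3 \<theta> = 1 / sqrt 6 * (2 / 3)" unfolding eta_def si by (simp only: co)
  also have "\<dots> = sqrt 6 / 9" by (simp add: field_simps)
  finally show "eta 3 \<theta> = sqrt 6 / 9" .
qed

lemma eta_4_value:
  defines "\<theta> \<equiv> 2 * arcsin (7 / 25)"
  shows "0 < \<theta>" "(real 4 - 1) * \<theta> < 2 * pi / 3" "eta 4 \<theta> = 72072 / 390625"
proof -
  let ?x = "\<theta> / 2"
  have pos: "0 < ?x" using arcsin_less_arcsin[of 0 "7 / 25"] by (simp add: \<theta>_def)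
  thus "0 < \<theta>" by simp
  have ub: "?x < pi / 6" using arcsin_lt_pi_sixth[of "7 / 25"] by (simp add: \<theta>_def)
  have si: "sin ?x = 7 / 25" by (simp add: \<theta>_def)
  have "cos ?x = sqrt (1 - (7 / 25)\<^sup>2)" by (simp add: \<theta>_def cos_arcsin)
  also have "\<dots> = 24 / 25" by (rule real_sqrt_unique) (auto simp: power2_eq_square)
  finally have "cos (3 * ?x) = 4 * (24 / 25) ^ 3 - 3 * (24 / 25)"
    unfolding cos_treble_cos by (simp only:)
  hence co: "cos (3 * ?x) = 10296 / 15625" by (simp add: power3_eq_cube)
  have "3 * ?x < pi / 3"
  proof (rule ccontr)
    assume "\<not> ?thesis"
    hence "cos (3 * ?x) \<le> cos (pi / 3)" using ub by (intro cos_monotone_0_pi_le) auto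
    thus False unfolding co cos_60 by simp
  qed
  thus "(real 4 - 1) * \<theta> < 2 * pi / 3" by simp
  have "(real 4 - 1) * \<theta> / 2 = 3 * ?x" by simp
  thus "eta 4 \<theta> = 72072 / 390625" unfolding eta_def si by (simp only: co)
qed

lemma half_le_sin:
  fixes x :: real
  assumes "0 \<le> x" "x \<le> 1"
  shows "x / 2 \<le> sin x"
proof -
  have "\<bar>sin x - (\<Sum>m<3. sin_coeff m * x ^ m)\<bar> \<le> inverse (fact 3) * \<bar>x\<bar> ^ 3"
    by (rule Maclaurin_sin_bound)
  moreover have "(\<Sum>m<3. sin_coeff m * x ^ m) = x"
    by (simp add: eval_nat_numeral sin_coeff_def)
  moreover have "inverse (fact 3) * \<bar>x\<bar> ^ 3 = x ^ 3 / 6"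
    using assms by (simp add: fact_numeral)
  ultimately have "\<bar>sin x - x\<bar> \<le> x ^ 3 / 6" by metis
  moreover have "x ^ 3 \<le> x" using power_decreasing[of 1 3 x] assms by simp
  ultimately show ?thesis using assms(1) by linarith
qed

lemma eta_inverse_ge:
  assumes "d \<ge> 2"
  shows "1 / (8 * real d) \<le> eta d (1 / (real d - 1))"
proof -
  let ?x = "1 / (real d - 1) / 2"
  have x: "0 < ?x" "?x \<le> 1" "1 / (2 * real d) \<le> ?x" using assms by (auto simp: field_simps)
  have s: "?x / 2 \<le> sin ?x" using x by (intro half_le_sin) auto
  have "cos (pi / 3) \<le> cos (1 / 2)"
    using pi_ge_two by (intro cos_monotone_0_pi_le) auto
  hence c: "1 / 2 \<le> cos (1 / 2 :: real)" by (simp add: cos_60)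
  have "1 / (8 * real d) = 1 / (2 * real d) / 2 * (1 / 2)" by simp
  also have "\<dots> \<le> ?x / 2 * (1 / 2)" using x(3) by (intro mult_right_mono divide_right_mono) auto
  also have "\<dots> \<le> sin ?x * cos (1 / 2)"
  proof (rule mult_mono[OF s c])
    show "0 \<le> sin ?x" by (rule order_trans[OF _ s]) (use assms in simp)
  qed simp
  also have "\<dots> = eta d (1 / (real d - 1))" using assms by (simp add: eta_def)
  finally show ?thesis .
qed

lemma eta_2_value: "eta 2 (pi / 2) = 1 / 2"
proof -
  have "eta 2 (pi / 2) = sin (pi / 4) * cos (pi / 4)" by (simp add: eta_def)
  also have "\<dots> = 1 / 2" by (simp add: sin_45 cos_45)
  finally show ?thesis .
qed

theorem theorem3p2:
  shows "(\<forall>(d::nat) (\<theta>::real). 2 \<le> d \<and> 0 < \<theta> \<and> (real d - 1) * \<theta> < 2 * pi / 3 \<longrightarrow>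
            0 < eta d \<theta> \<and> eta d \<theta> < 1 \<and>
            (\<forall>(n::nat) (Z :: nat list \<Rightarrow> complex).
               1 \<le> n \<and> (\<forall>js \<in> tensor_indices d n. cmod (1 - Z js) \<le> eta d \<theta>) \<longrightarrow>
               PER d n Z \<noteq> 0)) \<and>
         (\<exists>\<theta> :: nat \<Rightarrow> real.
            (\<forall>d\<ge>2. 0 < \<theta> d \<and> (real d - 1) * \<theta> d < 2 * pi / 3) \<and>
            eta 2 (\<theta> 2) = 0.5 \<and>
            eta 3 (\<theta> 3) = sqrt 6 / 9 \<and> 0.272 \<le> eta 3 (\<theta> 3) \<and> eta 3 (\<theta> 3) < 0.273 \<and>
            0.184 \<le> eta 4 (\<theta> 4) \<and> eta 4 (\<theta> 4) < 0.185 \<and>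
            (\<exists>c>0. \<forall>d\<ge>2. c / real d \<le> eta d (\<theta> d)))"
proof (intro conjI)
  show "\<forall>(d::nat) (\<theta>::real). 2 \<le> d \<and> 0 < \<theta> \<and> (real d - 1) * \<theta> < 2 * pi / 3 \<longrightarrow>
            0 < eta d \<theta> \<and> eta d \<theta> < 1 \<and>
            (\<forall>(n::nat) (Z :: nat list \<Rightarrow> complex).
               1 \<le> n \<and> (\<forall>js \<in> tensor_indices d n. cmod (1 - Z js) \<le> eta d \<theta>) \<longrightarrow>
               PER d n Z \<noteq> 0)"
    using eta_bounds PER_nonzero by blast
next
  define \<theta> :: "nat \<Rightarrow> real" where "\<theta> d =
    (if d = 2 then pi / 2 else if d = 3 then 2 * arcsin (1 / sqrt 6)
     else if d = 4 then 2 * arcsin (7 / 25) else 1 / (real d - 1))" for d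
  have v: "\<theta> 2 = pi / 2" "\<theta> 3 = 2 * arcsin (1 / sqrt 6)" "\<theta> 4 = 2 * arcsin (7 / 25)"
    by (auto simp: \<theta>_def)
  have e: "eta 2 (\<theta> 2) = 1 / 2" "eta 3 (\<theta> 3) = sqrt 6 / 9" "eta 4 (\<theta> 4) = 72072 / 390625"
    unfolding v by (rule eta_2_value eta_3_value eta_4_value)+
  have six: "2.448 \<le> sqrt 6" "sqrt 6 < 2.457"
    by (rule real_le_rsqrt, simp add: power2_eq_square)
       (rule real_less_lsqrt, simp_all add: power2_eq_square)
  have adm: "0 < \<theta> d \<and> (real d - 1) * \<theta> d < 2 * pi / 3" if "d \<ge> 2" for d
  proof -
    have "d = 2 \<or> d = 3 \<or> d = 4 \<or> d > 4" using that by arith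
    then consider "d = 2" | "d = 3" | "d = 4" | "d > 4" by blast
    thus ?thesis
    proof cases
      case 1 thus ?thesis by (simp add: v)
    next
      case 2 thus ?thesis using eta_3_value(1,2) by (simp add: v)
    next
      case 3 thus ?thesis using eta_4_value(1,2) by (simp add: v)
    next
      case 4 thus ?thesis using pi_ge_two by (simp add: \<theta>_def)
    qed
  qed
  have ge: "(1 / 8) / real d \<le> eta d (\<theta> d)" if "d \<ge> 2" for d
  proof -
    have "d = 2 \<or> d = 3 \<or> d = 4 \<or> d > 4" using that by arith
    then consider "d = 2" | "d = 3" | "d = 4" | "d > 4" by blast
    thus ?thesis
    proof cases
      case 1 thus ?thesis by (simp add: e)
    next
      case 2 thus ?thesis using six(1) by (simp add: e)
    next
      case 3 thus ?thesis by (simp add: e)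
    next
      case 4 thus ?thesis using eta_inverse_ge[OF that] by (simp add: \<theta>_def)
    qed
  qed
  show "\<exists>\<theta> :: nat \<Rightarrow> real.
            (\<forall>d\<ge>2. 0 < \<theta> d \<and> (real d - 1) * \<theta> d < 2 * pi / 3) \<and>
            eta 2 (\<theta> 2) = 0.5 \<and>
            eta 3 (\<theta> 3) = sqrt 6 / 9 \<and> 0.272 \<le> eta 3 (\<theta> 3) \<and> eta 3 (\<theta> 3) < 0.273 \<and>
            0.184 \<le> eta 4 (\<theta> 4) \<and> eta 4 (\<theta> 4) < 0.185 \<and>
            (\<exists>c>0. \<forall>d\<ge>2. c / real d \<le> eta d (\<theta> d))"
  proof (intro exI[of _ \<theta>] conjI)
    show "\<exists>c>0. \<forall>d\<ge>2. c / real d \<le> eta d (\<theta> d)"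
      using ge by (intro exI[of _ "1 / 8"]) auto
  qed (use adm e six in auto)
qed

end
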